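(* For a semigroup $X$ the following conditions are equivalent: (1) $N_2(X)$ is a commutative Clifford semigroup; (2) $N_2(X)$ is an inverse semigroup; (3) the idempotents of the semigroup $N_2(X)$ commute, and $N_2(X)$ is sub-Clifford or regular; (4) $X$ is isomorphic to $C_2$ or to $L_n$ for some $n\in\omega$.
   Context: An upfamily on a set $X$ is a family $\mathcal F$ of nonempty subsets of $X$ such that $F\in\mathcal F$ and $F\subset E\subset X$ imply $E\in\mathcal F$. $\upsilon(X)$ is the set of all upfamilies on $X$; $N_2(X)$ is the set of linked upfamilies, i.e. those with $A\cap B\ne\emptyset$ for all members $A,B$. Each $x\in X$ is identified with $\langle x\rangle=\{A\subset X: x\in A\}$. For a family $\mathcal C$ of nonempty subsets, $\langle\mathcal C\rangle=\{A\subset X:\exists C\in\mathcal C,\ C\subset A\}$. For a semigroup $(X,* )$ the operation is extended to $\upsilon(X)$ by $\mathcal A*\mathcal B=\big\langle \bigcup_{a\in A} a*B_a : A\in\mathcal A,\ \{B_a\}_{a\in A}\subset\mathcal B\big\rangle$; $N_2(X)$ is a subsemigroup. A semigroup $S$ is inverse if each $x$ has a unique $x^{-1}$ with $xx^{-1}x=x$, $x^{-1}xx^{-1}=x^{-1}$; regular if $x\in xSx$ for all $x$; Clifford if it is a union of groups; sub-Clifford if it is a union of cancellative subsemigroups. $C_n=\{z\in\mathbb C: z^n=1\}$; $L_n=\{0,\dots,n-1\}$ with the operation $\min$ ($L_0=\emptyset$). *)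

theory Defs
  imports Complex_Main
begin

definition semigroup_on :: "'a set \<Rightarrow> ('a \<Rightarrow> 'a \<Rightarrow> 'a) \<Rightarrow> bool" where
  "semigroup_on X f \<longleftrightarrow> (\<forall>a\<in>X. \<forall>b\<in>X. f a b \<in> X) \<and>
     (\<forall>a\<in>X. \<forall>b\<in>X. \<forall>c\<in>X. f (f a b) c = f a (f b c))"

definition upfamily :: "'a set \<Rightarrow> 'a set set \<Rightarrow> bool" where
  "upfamily X \<F> \<longleftrightarrow> (\<forall>A\<in>\<F>. A \<noteq> {} \<and> A \<subseteq> X) \<and>
     (\<forall>F\<in>\<F>. \<forall>E. F \<subseteq> E \<and> E \<subseteq> X \<longrightarrow> E \<in> \<F>)"

definition linked :: "'a set set \<Rightarrow> bool" where
  "linked \<F> \<longleftrightarrow> (\<forall>A\<in>\<F>. \<forall>B\<in>\<F>. A \<inter> B \<noteq> {})"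

definition N2 :: "'a set \<Rightarrow> 'a set set set" where
  "N2 X = {\<F>. upfamily X \<F> \<and> linked \<F>}"

definition ext_op :: "'a set \<Rightarrow> ('a \<Rightarrow> 'a \<Rightarrow> 'a) \<Rightarrow> 'a set set \<Rightarrow> 'a set set \<Rightarrow> 'a set set" where
  "ext_op X f \<A> \<B> = {E. E \<subseteq> X \<and> (\<exists>A\<in>\<A>. \<exists>B. (\<forall>a\<in>A. B a \<in> \<B>) \<and>
       (\<Union>a\<in>A. f a ` B a) \<subseteq> E)}"

definition commutative_on :: "'s set \<Rightarrow> ('s \<Rightarrow> 's \<Rightarrow> 's) \<Rightarrow> bool" where
  "commutative_on S g \<longleftrightarrow> (\<forall>x\<in>S. \<forall>y\<in>S. g x y = g y x)"

definition inverse_semigroup_on :: "'s set \<Rightarrow> ('s \<Rightarrow> 's \<Rightarrow> 's) \<Rightarrow> bool" where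
  "inverse_semigroup_on S g \<longleftrightarrow>
     (\<forall>x\<in>S. \<exists>!y. y \<in> S \<and> g (g x y) x = x \<and> g (g y x) y = y)"

definition regular_on :: "'s set \<Rightarrow> ('s \<Rightarrow> 's \<Rightarrow> 's) \<Rightarrow> bool" where
  "regular_on S g \<longleftrightarrow> (\<forall>x\<in>S. \<exists>y\<in>S. g (g x y) x = x)"

definition idempotents_commute_on :: "'s set \<Rightarrow> ('s \<Rightarrow> 's \<Rightarrow> 's) \<Rightarrow> bool" where
  "idempotents_commute_on S g \<longleftrightarrow>
     (\<forall>e\<in>S. \<forall>h\<in>S. g e e = e \<and> g h h = h \<longrightarrow> g e h = g h e)"

text \<open>G is a subgroup (subset forming a group under g; associativity inherited).\<close>
definition subgroup_on :: "'s set \<Rightarrow> ('s \<Rightarrow> 's \<Rightarrow> 's) \<Rightarrow> bool" where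
  "subgroup_on G g \<longleftrightarrow> (\<forall>x\<in>G. \<forall>y\<in>G. g x y \<in> G) \<and>
     (\<exists>e\<in>G. (\<forall>x\<in>G. g e x = x \<and> g x e = x) \<and> (\<forall>x\<in>G. \<exists>y\<in>G. g x y = e \<and> g y x = e))"

definition clifford_on :: "'s set \<Rightarrow> ('s \<Rightarrow> 's \<Rightarrow> 's) \<Rightarrow> bool" where
  "clifford_on S g \<longleftrightarrow> (\<forall>x\<in>S. \<exists>G. G \<subseteq> S \<and> x \<in> G \<and> subgroup_on G g)"

definition cancellative_subsemigroup_on :: "'s set \<Rightarrow> ('s \<Rightarrow> 's \<Rightarrow> 's) \<Rightarrow> bool" where
  "cancellative_subsemigroup_on T g \<longleftrightarrow> (\<forall>x\<in>T. \<forall>y\<in>T. g x y \<in> T) \<and>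
     (\<forall>a\<in>T. \<forall>b\<in>T. \<forall>c\<in>T. (g a b = g a c \<longrightarrow> b = c) \<and> (g b a = g c a \<longrightarrow> b = c))"

definition sub_clifford_on :: "'s set \<Rightarrow> ('s \<Rightarrow> 's \<Rightarrow> 's) \<Rightarrow> bool" where
  "sub_clifford_on S g \<longleftrightarrow> (\<forall>x\<in>S. \<exists>T. T \<subseteq> S \<and> x \<in> T \<and> cancellative_subsemigroup_on T g)"

definition semigroup_iso :: "'a set \<Rightarrow> ('a \<Rightarrow> 'a \<Rightarrow> 'a) \<Rightarrow> 'b set \<Rightarrow> ('b \<Rightarrow> 'b \<Rightarrow> 'b) \<Rightarrow> bool" where
  "semigroup_iso X f Y g \<longleftrightarrow>
     (\<exists>h. bij_betw h X Y \<and> (\<forall>a\<in>X. \<forall>b\<in>X. h (f a b) = g (h a) (h b)))"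

definition C :: "nat \<Rightarrow> complex set" where
  "C n = {z. z ^ n = 1}"

definition L :: "nat \<Rightarrow> nat set" where
  "L n = {0..<n}"

end

theory Submission
  imports Defs "HOL-Library.Ramsey"
begin

text \<open>For the implication from (3) to (4) one exhibits bad linked upfamilies. A family generated
  by one set \<open>F\<close> with \<open>FFF = FF \<noteq> F\<close> lies in no cancellative subsemigroup, and for suitable
  \<open>F\<close> it is not regular either. The sets \<open>{e, h}\<close> with \<open>e\<close>, \<open>h\<close> incomparable idempotents, \<open>{g, h}\<close> with
  \<open>g\<close> an involution over the idempotent \<open>g\<^sup>2 < h\<close>, and \<open>{1, a, b}\<close> in the Klein four-group are of
  this kind. Families generated by \<open>{u, x}\<close>, respectively by tails of powers of \<open>x\<close>, force
  \<open>x\<^sup>3 = x\<close>. Noncommuting idempotents exclude the remaining cases: \<open>\<langle>{e, g}\<rangle>\<close> and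
  \<open>\<langle>{e, 0}, {g, 0}\<rangle>\<close> for a two-element group with zero, and the tail filters of the even and odd
  terms of a strictly monotone sequence in an infinite chain. What is left is the two-element group
  or a finite chain; over a finite chain the operation is commutative and idempotent.\<close>

section \<open>Inverse, regular and commutative Clifford semigroups\<close>

text \<open>If \<open>x\<close> is the inverse of \<open>ab\<close> for idempotents
  \<open>a\<close>, \<open>b\<close>, then so is \<open>bxa\<close>, hence \<open>x = bxa\<close> is
  idempotent. As \<open>x\<close> then has both \<open>x\<close> and \<open>ab\<close> as inverses,
  \<open>ab = x\<close> is idempotent. Applied to \<open>eh\<close> and \<open>he\<close>, this
  makes both of them inverses of \<open>eh\<close>.\<close>

lemma inverse_idempotents_commute:
  assumes S: "semigroup_on S g" and inv: "inverse_semigroup_on S g"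
  shows "idempotents_commute_on S g"
  unfolding idempotents_commute_on_def
proof (intro ballI impI)
  fix e h assume e: "e \<in> S" and h: "h \<in> S" and id: "g e e = e \<and> g h h = h"
  have cl: "g a b \<in> S" if "a \<in> S" "b \<in> S" for a b
    using S that unfolding semigroup_on_def by blast
  have as: "g (g a b) c = g a (g b c)" if "a \<in> S" "b \<in> S" "c \<in> S" for a b c
    using S that unfolding semigroup_on_def by blast
  have uniq: "y = z" if "x \<in> S" "y \<in> S" "z \<in> S" "g (g x y) x = x" "g (g y x) y = y"
     "g (g x z) x = x" "g (g z x) z = z" for x y z
    using inv that unfolding inverse_semigroup_on_def by blast
  have ide: "g e (g e z) = g e z" if "z \<in> S" for z using as[of e e z] id e that by simp
  have idh: "g h (g h z) = g h z" if "z \<in> S" for z using as[of h h z] id h that by simp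
  have idem: "g (g a b) (g a b) = g a b"
    if a: "a \<in> S" and b: "b \<in> S" and aa: "g a a = a" and bb: "g b b = b" for a b
  proof -
    have ia: "g a (g a z) = g a z" if "z \<in> S" for z using as[of a a z] aa a that by simp
    have ib: "g b (g b z) = g b z" if "z \<in> S" for z using as[of b b z] bb b that by simp
    obtain x where x: "x \<in> S" "g (g (g a b) x) (g a b) = g a b" "g (g x (g a b)) x = x"
      using inv cl[OF a b] unfolding inverse_semigroup_on_def by blast
    have x1: "g a (g b (g x (g a b))) = g a b" using x(2) a b x(1) by (simp add: as cl)
    have x2: "g x (g a (g b x)) = x" using x(3) a b x(1) by (simp add: as cl)
    have x2': "g x (g a (g b (g x z))) = g x z" if "z \<in> S" for z
      using arg_cong[OF x2, of "\<lambda>t. g t z"] a b x(1) that by (simp add: as cl)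
    let ?y = "g b (g x a)"
    have y: "?y \<in> S" using a b x by (simp add: cl)
    have yy: "g ?y ?y = ?y" using a b x x2' by (simp add: as cl)
    have "x = ?y"
      by (rule uniq[OF cl[OF a b] x(1) y x(2,3)]; use a b x x1 x2' in \<open>simp add: as cl ia ib\<close>)
    then have xx: "g x x = x" using yy by simp
    have "g a b = x"
      by (rule uniq[of x]; use a b x xx in \<open>simp add: cl\<close>)
    then show ?thesis using xx by simp
  qed
  have eh: "g (g e h) (g e h) = g e h" and he: "g (g h e) (g h e) = g h e"
    using idem e h id by auto
  have 1: "g e (g h (g e h)) = g e h" "g h (g e (g h e)) = g h e"
    using eh he e h by (simp_all add: as cl)
  show "g e h = g h e"
    by (rule uniq[of "g e h"]; use e h 1 ide idh in \<open>simp add: as cl\<close>)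
qed

lemma inverse_imp_regular: "inverse_semigroup_on S g \<Longrightarrow> regular_on S g"
  unfolding inverse_semigroup_on_def regular_on_def by (meson ex1_implies_ex)

text \<open>The group inverse \<open>y\<close> works. For another inverse \<open>z\<close>,
  commutativity lets \<open>y\<close> and \<open>z\<close> change places:
  \<open>z = zxyxz = yxzxz = yxz\<close>, and in the same way \<open>yxz = y\<close>.\<close>

lemma commutative_clifford_imp_inverse:
  assumes S: "semigroup_on S g" and comm: "commutative_on S g" and cliff: "clifford_on S g"
  shows "inverse_semigroup_on S g"
  unfolding inverse_semigroup_on_def
proof
  fix x assume x: "x \<in> S"
  have cl: "g a b \<in> S" if "a \<in> S" "b \<in> S" for a b
    using S that unfolding semigroup_on_def by blast
  have as: "g (g a b) c = g a (g b c)" if "a \<in> S" "b \<in> S" "c \<in> S" for a b c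
    using S that unfolding semigroup_on_def by blast
  have cm: "g a b = g b a" if "a \<in> S" "b \<in> S" for a b
    using comm that unfolding commutative_on_def by blast
  have lc: "g a (g b c) = g b (g a c)" if "a \<in> S" "b \<in> S" "c \<in> S" for a b c
    using as[of a b c] as[of b a c] cm[of a b] that by simp
  obtain G where G: "G \<subseteq> S" "x \<in> G" "subgroup_on G g"
    using cliff x unfolding clifford_on_def by blast
  then obtain e where e: "e \<in> G" "\<forall>x\<in>G. g e x = x \<and> g x e = x"
      "\<forall>x\<in>G. \<exists>y\<in>G. g x y = e \<and> g y x = e"
    unfolding subgroup_on_def by blast
  then obtain y where y: "y \<in> G" "g x y = e" "g y x = e"
    using G(2) by blast
  show "\<exists>!y. y \<in> S \<and> g (g x y) x = x \<and> g (g y x) y = y"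
  proof (rule ex1I)
    show "y \<in> S \<and> g (g x y) x = x \<and> g (g y x) y = y" using G e y by auto
    fix z assume z: "z \<in> S \<and> g (g x z) x = x \<and> g (g z x) z = z"
    have yS: "y \<in> S" and zS: "z \<in> S" using G y z by auto
    have "z = g (g z x) z" using z by simp
    also have "\<dots> = g (g z (g (g x y) x)) z" using G e y by auto
    also have "\<dots> = g (g y (g (g x z) x)) z"
      using x yS zS by (simp add: as cl cm lc)
    also have "\<dots> = g (g y x) z" using z by simp
    also have "\<dots> = g (g y (g (g x y) x)) z" using G e y by auto
    also have "\<dots> = g (g y (g (g x z) x)) y"
      using x yS zS by (simp add: as cl cm lc)
    also have "\<dots> = y" using z y e by auto
    finally show "z = y" .
  qed
qed

section \<open>Families generated by one set or by the tails of a sequence\<close>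

definition principal_family :: "'a set \<Rightarrow> 'a set \<Rightarrow> 'a set set" where
  "principal_family X S = {E. S \<subseteq> E \<and> E \<subseteq> X}"

text \<open>The filter of tails of \<open>p\<close> along \<open>S\<close>. Keeping \<open>p\<close>
  and varying the index set allows families along one sequence to be compared.\<close>

definition tail_family :: "'a set \<Rightarrow> (nat \<Rightarrow> 'a) \<Rightarrow> nat set \<Rightarrow> 'a set set" where
  "tail_family X p S = {E. E \<subseteq> X \<and> (\<exists>N. \<forall>n\<in>S. N \<le> n \<longrightarrow> p n \<in> E)}"

lemma mem_principal: "E \<in> principal_family X S \<longleftrightarrow> S \<subseteq> E \<and> E \<subseteq> X"
  by (simp add: principal_family_def)

lemma mem_tail_family:
  "E \<in> tail_family X p S \<longleftrightarrow> E \<subseteq> X \<and> (\<exists>N. \<forall>n\<in>S. N \<le> n \<longrightarrow> p n \<in> E)"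
  by (simp add: tail_family_def)

lemma N2D: "\<F> \<in> N2 X \<Longrightarrow> upfamily X \<F>" "\<F> \<in> N2 X \<Longrightarrow> linked \<F>"
  by (auto simp: N2_def)

lemma upfamily_mono: "upfamily X \<F> \<Longrightarrow> A \<in> \<F> \<Longrightarrow> A \<subseteq> E \<Longrightarrow> E \<subseteq> X \<Longrightarrow> E \<in> \<F>"
  unfolding upfamily_def by blast

lemma upfamily_sub: "upfamily X \<F> \<Longrightarrow> A \<in> \<F> \<Longrightarrow> A \<subseteq> X"
  unfolding upfamily_def by blast

lemma principal_in_N2: "S \<noteq> {} \<Longrightarrow> principal_family X S \<in> N2 X"
  unfolding N2_def upfamily_def linked_def principal_family_def by blast

lemma principal_inj: "S \<subseteq> X \<Longrightarrow> T \<subseteq> X \<Longrightarrow> principal_family X S = principal_family X T \<Longrightarrow> S = T"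
  unfolding principal_family_def by blast

lemma tail_family_in_N2:
  assumes "infinite S"
  shows "tail_family X p S \<in> N2 X"
proof -
  have "\<exists>n\<in>S. p n \<in> A \<and> p n \<in> B"
    if A: "A \<in> tail_family X p S" and B: "B \<in> tail_family X p S" for A B
  proof -
    obtain M N where "\<forall>n\<in>S. M \<le> n \<longrightarrow> p n \<in> A" "\<forall>n\<in>S. N \<le> n \<longrightarrow> p n \<in> B"
      using A B unfolding mem_tail_family by blast
    moreover obtain n where "n \<in> S" "max M N \<le> n"
      using assms unfolding infinite_nat_iff_unbounded_le by blast
    ultimately show ?thesis by auto
  qed
  then show ?thesis
    unfolding N2_def upfamily_def linked_def
    by (auto simp: mem_tail_family) blast+
qed

section \<open>The extended operation\<close>

locale semigroup_carrier =
  fixes X :: "'a set" and f :: "'a \<Rightarrow> 'a \<Rightarrow> 'a" (infixl "\<cdot>" 70)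
  assumes semigroup: "semigroup_on X f"
begin

abbreviation star :: "'a set set \<Rightarrow> 'a set set \<Rightarrow> 'a set set" (infixl "\<star>" 70) where
  "\<A> \<star> \<B> \<equiv> ext_op X f \<A> \<B>"

lemma closed [simp, intro]: "a \<in> X \<Longrightarrow> b \<in> X \<Longrightarrow> a \<cdot> b \<in> X"
  using semigroup unfolding semigroup_on_def by blast

lemma assoc: "a \<in> X \<Longrightarrow> b \<in> X \<Longrightarrow> c \<in> X \<Longrightarrow> a \<cdot> b \<cdot> c = a \<cdot> (b \<cdot> c)"
  using semigroup unfolding semigroup_on_def by blast

lemma mem_ext_op:
  "E \<in> \<A> \<star> \<B> \<longleftrightarrow> E \<subseteq> X \<and> (\<exists>A\<in>\<A>. \<forall>a\<in>A. \<exists>B\<in>\<B>. f a ` B \<subseteq> E)"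
proof -
  have "(\<exists>B. (\<forall>a\<in>A. B a \<in> \<B>) \<and> (\<Union>a\<in>A. f a ` B a) \<subseteq> E) \<longleftrightarrow>
      (\<exists>B. \<forall>a\<in>A. B a \<in> \<B> \<and> f a ` B a \<subseteq> E)" for A
    by (simp only: UN_subset_iff ball_conj_distrib)
  moreover have "(\<exists>B. \<forall>a\<in>A. B a \<in> \<B> \<and> f a ` B a \<subseteq> E) \<longleftrightarrow>
      (\<forall>a\<in>A. \<exists>B\<in>\<B>. f a ` B \<subseteq> E)" for A
    unfolding Bex_def bchoice_iff ..
  ultimately show ?thesis by (simp add: ext_op_def)
qed

text \<open>The same formula as for the product of ultrafilters; iterating it makes associativity
  of the extended operation immediate.\<close>

lemma mem_star_iff:
  assumes A: "upfamily X \<A>" and B: "upfamily X \<B>"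
  shows "E \<in> \<A> \<star> \<B> \<longleftrightarrow> E \<subseteq> X \<and> {a \<in> X. {b \<in> X. a \<cdot> b \<in> E} \<in> \<B>} \<in> \<A>"
proof -
  have *: "(\<exists>B\<in>\<B>. f a ` B \<subseteq> E) \<longleftrightarrow> {b \<in> X. a \<cdot> b \<in> E} \<in> \<B>" for a
  proof
    assume "\<exists>B\<in>\<B>. f a ` B \<subseteq> E"
    then obtain B' where B': "B' \<in> \<B>" "f a ` B' \<subseteq> E" by blast
    then have "B' \<subseteq> {b \<in> X. a \<cdot> b \<in> E}" using upfamily_sub[OF B, of B'] by auto
    then show "{b \<in> X. a \<cdot> b \<in> E} \<in> \<B>" using upfamily_mono[OF B B'(1)] by blast
  qed (rule bexI[of _ "{b \<in> X. a \<cdot> b \<in> E}"], auto)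
  have **: "(\<exists>A\<in>\<A>. \<forall>a\<in>A. P a) \<longleftrightarrow> {a \<in> X. P a} \<in> \<A>" for P
  proof
    assume "\<exists>A\<in>\<A>. \<forall>a\<in>A. P a"
    then obtain A' where A': "A' \<in> \<A>" "\<forall>a\<in>A'. P a" by blast
    then have "A' \<subseteq> {a \<in> X. P a}" using upfamily_sub[OF A, of A'] by auto
    then show "{a \<in> X. P a} \<in> \<A>" using upfamily_mono[OF A A'(1)] by blast
  qed (rule bexI[of _ "{a \<in> X. P a}"], auto)
  show ?thesis by (simp only: mem_ext_op * **)
qed

lemma star_upfamily:
  assumes A: "upfamily X \<A>" and B: "upfamily X \<B>"
  shows "upfamily X (\<A> \<star> \<B>)"
proof -
  have "{} \<notin> \<A>" "{} \<notin> \<B>" using A B unfolding upfamily_def by auto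
  then have "{} \<notin> \<A> \<star> \<B>" unfolding mem_ext_op by fastforce
  moreover have "E' \<in> \<A> \<star> \<B>" if "E \<in> \<A> \<star> \<B>" "E \<subseteq> E'" "E' \<subseteq> X" for E E'
    using that unfolding mem_ext_op by (meson subset_trans)
  moreover have "E \<subseteq> X" if "E \<in> \<A> \<star> \<B>" for E
    using that unfolding mem_ext_op by blast
  ultimately show ?thesis unfolding upfamily_def by metis
qed

lemma star_linked:
  assumes "linked \<A>" "linked \<B>"
  shows "linked (\<A> \<star> \<B>)"
  unfolding linked_def
proof (intro ballI)
  fix E E' assume E: "E \<in> \<A> \<star> \<B>" "E' \<in> \<A> \<star> \<B>"
  obtain A where A: "A \<in> \<A>" "\<forall>a\<in>A. \<exists>B\<in>\<B>. f a ` B \<subseteq> E" using E(1) unfolding mem_ext_op by blast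
  obtain A' where A': "A' \<in> \<A>" "\<forall>a\<in>A'. \<exists>B\<in>\<B>. f a ` B \<subseteq> E'" using E(2) unfolding mem_ext_op by blast
  obtain a where a: "a \<in> A" "a \<in> A'" using assms(1) A(1) A'(1) unfolding linked_def by blast
  obtain B B' where B: "B \<in> \<B>" "f a ` B \<subseteq> E" "B' \<in> \<B>" "f a ` B' \<subseteq> E'"
    using A(2) A'(2) a by meson
  then obtain b where "b \<in> B" "b \<in> B'" using assms(2) unfolding linked_def by blast
  then show "E \<inter> E' \<noteq> {}" using B by auto
qed

lemma star_closed: "\<A> \<in> N2 X \<Longrightarrow> \<B> \<in> N2 X \<Longrightarrow> \<A> \<star> \<B> \<in> N2 X"
  by (simp add: N2_def star_upfamily star_linked)

lemma star_assoc:
  assumes "upfamily X \<A>" "upfamily X \<B>" "upfamily X \<C>"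
  shows "\<A> \<star> \<B> \<star> \<C> = \<A> \<star> (\<B> \<star> \<C>)"
proof (rule set_eqI)
  fix E
  have inner: "{c \<in> X. a \<cdot> b \<cdot> c \<in> E} = {c \<in> X. a \<cdot> (b \<cdot> c) \<in> E}" if "a \<in> X" "b \<in> X" for a b
    using that by (auto simp: assoc)
  have "E \<in> \<A> \<star> \<B> \<star> \<C> \<longleftrightarrow>
      E \<subseteq> X \<and> {a \<in> X. {b \<in> X. {c \<in> X. a \<cdot> b \<cdot> c \<in> E} \<in> \<C>} \<in> \<B>} \<in> \<A>"
    by (simp add: mem_star_iff star_upfamily assms cong: conj_cong)
  moreover have "E \<in> \<A> \<star> (\<B> \<star> \<C>) \<longleftrightarrow>
      E \<subseteq> X \<and> {a \<in> X. {b \<in> X. {c \<in> X. a \<cdot> (b \<cdot> c) \<in> E} \<in> \<C>} \<in> \<B>} \<in> \<A>"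
    by (simp add: mem_star_iff star_upfamily assms cong: conj_cong)
  ultimately show "E \<in> \<A> \<star> \<B> \<star> \<C> \<longleftrightarrow> E \<in> \<A> \<star> (\<B> \<star> \<C>)"
    by (simp add: inner cong: conj_cong)
qed

lemma N2_semigroup: "semigroup_on (N2 X) (ext_op X f)"
  unfolding semigroup_on_def using star_closed star_assoc N2D(1) by blast

lemma mem_principal_star:
  assumes "S \<noteq> {}" "S \<subseteq> X" "upfamily X \<B>"
  shows "E \<in> principal_family X S \<star> \<B> \<longleftrightarrow> E \<subseteq> X \<and> (\<forall>a\<in>S. {b \<in> X. a \<cdot> b \<in> E} \<in> \<B>)"
  using mem_star_iff[OF N2D(1)[OF principal_in_N2[OF assms(1)]] assms(3)] assms(2)
  unfolding mem_principal by auto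

lemma principal_star:
  assumes "S \<noteq> {}" "S \<subseteq> X" "T \<noteq> {}" "T \<subseteq> X"
  shows "principal_family X S \<star> principal_family X T = principal_family X (\<Union>a\<in>S. f a ` T)"
  using assms
  by (intro set_eqI)
     (simp add: mem_principal_star N2D(1)[OF principal_in_N2] mem_principal image_subset_iff
       UN_subset_iff subset_iff, blast)

lemma principal_singleton_star:
  "x \<in> X \<Longrightarrow> y \<in> X \<Longrightarrow> principal_family X {x} \<star> principal_family X {y} = principal_family X {x \<cdot> y}"
  by (simp add: principal_star)

text \<open>A single \<open>b\<close> serves both \<open>x1\<close> and \<open>x2\<close> because the pseudo-inverse of \<open>principal_family X F\<close> is linked.\<close>

lemma regular_principal:
  assumes reg: "regular_on (N2 X) (ext_op X f)"
    and F: "F \<subseteq> X" and x: "x1 \<in> F" "x2 \<in> F"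
  shows "\<exists>b\<in>X. \<forall>y\<in>F. x1 \<cdot> b \<cdot> y \<in> F \<and> x2 \<cdot> b \<cdot> y \<in> F"
proof -
  have ne: "F \<noteq> {}" using x by auto
  obtain \<B> where B: "\<B> \<in> N2 X" "principal_family X F \<star> \<B> \<star> principal_family X F = principal_family X F"
    using reg principal_in_N2[OF ne] unfolding regular_on_def by blast
  note up = N2D(1)[OF B(1)] N2D(1)[OF principal_in_N2[OF ne, of X]]
  have "F \<in> principal_family X F \<star> \<B> \<star> principal_family X F"
    using B(2) F by (simp add: mem_principal)
  then have "{d \<in> X. {y \<in> X. d \<cdot> y \<in> F} \<in> principal_family X F} \<in> principal_family X F \<star> \<B>"
    using mem_star_iff[OF star_upfamily[OF up(2,1)] up(2)] by blast
  then have *: "{b \<in> X. x \<cdot> b \<in> {d \<in> X. {y \<in> X. d \<cdot> y \<in> F} \<in> principal_family X F}} \<in> \<B>" if "x \<in> F" for x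
    using mem_principal_star[OF ne F up(1)] that by blast
  show ?thesis
    using N2D(2)[OF B(1), unfolded linked_def, rule_format, OF *[OF x(1)] *[OF x(2)]]
    by (auto simp: mem_principal)
qed

text \<open>Closure puts \<open>\<A> \<star> \<A>\<close> into the cancellative subsemigroup around
  \<open>\<A>\<close>, where one left factor \<open>\<A>\<close> cancels.\<close>

lemma sub_clifford_cube_eq_square:
  assumes "sub_clifford_on (N2 X) (ext_op X f)" "\<A> \<in> N2 X" "\<A> \<star> (\<A> \<star> \<A>) = \<A> \<star> \<A>"
  shows "\<A> \<star> \<A> = \<A>"
  using assms unfolding sub_clifford_on_def cancellative_subsemigroup_on_def by metis

text \<open>The form in which small sets \<open>F\<close> with \<open>FF = FFF\<close> are excluded
  below: their generated family has equal square and cube.\<close>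

lemma sub_clifford_principal:
  assumes "sub_clifford_on (N2 X) (ext_op X f)" "F \<noteq> {}" "F \<subseteq> X"
    and FF: "(\<Union>a\<in>F. f a ` F) = H" and FH: "(\<Union>a\<in>F. f a ` H) = H"
  shows "H = F"
proof -
  have H: "H \<subseteq> X" "H \<noteq> {}" using assms by auto
  have "principal_family X H = principal_family X F"
    using sub_clifford_cube_eq_square[OF assms(1) principal_in_N2[OF assms(2)]]
    by (simp add: principal_star assms(2,3) FF FH H)
  then show ?thesis by (rule principal_inj[OF H(1) assms(3)])
qed


lemma mem_tail_star:
  assumes "infinite S" "upfamily X \<B>" "range p \<subseteq> X"
  shows "E \<in> tail_family X p S \<star> \<B> \<longleftrightarrow>
    E \<subseteq> X \<and> (\<exists>N. \<forall>n\<in>S. N \<le> n \<longrightarrow> {b \<in> X. p n \<cdot> b \<in> E} \<in> \<B>)"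
proof -
  have p: "p n \<in> X" for n using assms(3) by auto
  have "{a \<in> X. P a} \<subseteq> X" for P by auto
  then show ?thesis
    by (simp add: mem_star_iff[OF N2D(1)[OF tail_family_in_N2[OF assms(1)]] assms(2)]
        mem_tail_family p)
qed

text \<open>The bound \<open>M\<close> may depend on \<open>n\<close>: the product is an iterated
  limit, and on an infinite chain it can depend on the order of the factors.\<close>

lemma mem_tail_star_tail:
  assumes S: "infinite S" and R: "infinite R" and p: "range p \<subseteq> X"
  shows "E \<in> tail_family X p S \<star> tail_family X p R \<longleftrightarrow>
    E \<subseteq> X \<and> (\<exists>N. \<forall>n\<in>S. N \<le> n \<longrightarrow> (\<exists>M. \<forall>m\<in>R. M \<le> m \<longrightarrow> p n \<cdot> p m \<in> E))"
proof -
  have "p n \<in> X" for n using p by auto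
  moreover have "{b \<in> X. P b} \<subseteq> X" for P by auto
  ultimately have "{b \<in> X. p n \<cdot> b \<in> E} \<in> tail_family X p R \<longleftrightarrow>
      (\<exists>M. \<forall>m\<in>R. M \<le> m \<longrightarrow> p n \<cdot> p m \<in> E)" for n
    by (simp add: mem_tail_family)
  then show ?thesis
    by (simp add: mem_tail_star[OF S N2D(1)[OF tail_family_in_N2[OF R]] p])
qed

subsection \<open>Powers of an element\<close>

definition power_seq :: "'a \<Rightarrow> nat \<Rightarrow> 'a" where
  "power_seq x n = (f x ^^ n) x"

lemma power_seq_0 [simp]: "power_seq x 0 = x"
  by (simp add: power_seq_def)

lemma power_seq_Suc: "power_seq x (Suc n) = x \<cdot> power_seq x n"
  by (simp add: power_seq_def)

lemma power_seq_in [simp]: "x \<in> X \<Longrightarrow> power_seq x n \<in> X"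
  by (induction n) (auto simp: power_seq_Suc)

lemma power_seq_mult: "x \<in> X \<Longrightarrow> power_seq x m \<cdot> power_seq x n = power_seq x (Suc (m + n))"
  by (induction m) (auto simp: power_seq_Suc assoc)

text \<open>The points of all powers of \<open>x\<close> lie in the cancellative subsemigroup around
  \<open>principal_family X {x}\<close>, so \<open>x\<close> can be cancelled one factor at a
  time.\<close>

lemma sub_clifford_power_cancel:
  assumes sub: "sub_clifford_on (N2 X) (ext_op X f)" and x: "x \<in> X"
    and eq: "power_seq x (i + n) = power_seq x (j + n)"
  shows "power_seq x i = power_seq x j"
proof -
  obtain T where T: "principal_family X {x} \<in> T" "cancellative_subsemigroup_on T (ext_op X f)"
    using sub principal_in_N2[of "{x}" X] unfolding sub_clifford_on_def by blast
  have step: "principal_family X {x} \<star> principal_family X {power_seq x n}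
      = principal_family X {power_seq x (Suc n)}" for n
    using x by (simp add: principal_singleton_star power_seq_Suc)
  have mem: "principal_family X {power_seq x n} \<in> T" for n
  proof (induction n)
    case (Suc n)
    then show ?case
      using T step[of n] unfolding cancellative_subsemigroup_on_def by metis
  qed (use T in simp)
  have cancel: "power_seq x i = power_seq x j" if "power_seq x (Suc i) = power_seq x (Suc j)" for i j
  proof -
    have "principal_family X {power_seq x i} = principal_family X {power_seq x j}"
      using T mem step that unfolding cancellative_subsemigroup_on_def by metis
    then show ?thesis using principal_inj[of "{power_seq x i}" X "{power_seq x j}"] x by simp
  qed
  show ?thesis using eq
  proof (induction n)
    case (Suc n)
    then show ?case using cancel[of "i + n" "j + n"] by simp
  qed simp
qed

text \<open>If exponents are determined modulo some \<open>k \<ge> 3\<close>, then the tails of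
  \<open>{x\<^sup>n | k does not divide n}\<close> generate a family whose square and cube are both
  generated by the tails of \<open>{x\<^sup>n}\<close>. The infinite order and the finite order case are treated
  alike. Note that \<open>power_seq x n\<close> is the power with exponent \<open>n + 1\<close>.\<close>

lemma sub_clifford_no_period:
  assumes sub: "sub_clifford_on (N2 X) (ext_op X f)" and x: "x \<in> X" and k: "3 \<le> k"
    and inj: "\<And>i j. power_seq x i = power_seq x j \<Longrightarrow> i mod k = j mod k"
  shows False
proof -
  define p where "p = power_seq x"
  have p: "range p \<subseteq> X" and pm: "p m \<cdot> p n = p (Suc (m + n))" for m n
    using x by (auto simp: p_def power_seq_mult)
  define S where "S = {n. Suc n mod k \<noteq> 0}"
  \<comment> \<open>The exponents are \<open>N * k + 1\<close> and \<open>N * k + 2\<close>; neither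
    is divisible by \<open>k\<close> because \<open>3 \<le> k\<close>.\<close>
  have S1: "N * k \<in> S" and S2: "N * k + 1 \<in> S" for N
    using k by (auto simp: S_def mod_Suc)
  have inf: "infinite S"
    unfolding infinite_nat_iff_unbounded_le
  proof
    fix m show "\<exists>n\<ge>m. n \<in> S" using S1[of m] k by (intro exI[of _ "m * k"]) auto
  qed
  have infU: "infinite (UNIV :: nat set)" by simp
  let ?A = "tail_family X p S" and ?U = "tail_family X p UNIV"
  have big: "E \<in> tail_family X p R \<star> tail_family X p R'"
    if "infinite R" "infinite R'" "E \<in> ?U" for E R R'
  proof -
    obtain N where N: "E \<subseteq> X" "\<forall>n\<ge>N. p n \<in> E" using \<open>E \<in> ?U\<close> by (auto simp: mem_tail_family)
    then have "\<forall>m\<in>R'. N \<le> m \<longrightarrow> p n \<cdot> p m \<in> E" for n by (auto simp: pm)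
    then show ?thesis using N mem_tail_star_tail[OF that(1,2) p] by blast
  qed
  have AA: "E \<in> ?U" if E: "E \<in> ?A \<star> ?A" for E
  proof -
    obtain N where N: "E \<subseteq> X" "\<forall>n\<in>S. N \<le> n \<longrightarrow> (\<exists>M. \<forall>m\<in>S. M \<le> m \<longrightarrow> p n \<cdot> p m \<in> E)"
      using E by (auto simp: mem_tail_star_tail[OF inf inf p])
    have "N \<le> N * k" using k by simp
    then have le: "N \<le> N * k" "N \<le> N * k + 1" by linarith+
    obtain M1 where M1: "\<forall>m\<in>S. M1 \<le> m \<longrightarrow> p (N * k) \<cdot> p m \<in> E"
      using N(2)[rule_format, OF S1 le(1)] by metis
    obtain M2 where M2: "\<forall>m\<in>S. M2 \<le> m \<longrightarrow> p (N * k + 1) \<cdot> p m \<in> E"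
      using N(2)[rule_format, OF S2 le(2)] by metis
    have "p n \<in> E" if n: "N * k + 2 + M1 + M2 \<le> n" for n
    proof -
      \<comment> \<open>\<open>p n\<close> factors with first factor \<open>p (N * k)\<close> and
        also with first factor \<open>p (N * k + 1)\<close>. The two cofactors have consecutive
        exponents, so \<open>k\<close> cannot divide both.\<close>
      define b where "b = n - (N * k + 2)"
      have nb: "n = Suc (N * k + Suc b)" "n = Suc (N * k + 1 + b)" using n by (auto simp: b_def)
      have "Suc b \<in> S \<or> b \<in> S"
        using k by (auto simp: S_def mod_Suc split: if_splits)
      moreover have "M1 \<le> Suc b" "M2 \<le> b" using n by (auto simp: b_def)
      ultimately have "p (N * k) \<cdot> p (Suc b) \<in> E \<or> p (N * k + 1) \<cdot> p b \<in> E"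
        using M1 M2 by metis
      then show ?thesis using nb by (auto simp: pm)
    qed
    then show ?thesis using N(1) by (auto simp: mem_tail_family)
  qed
  have AU: "E \<in> ?U" if E: "E \<in> ?A \<star> ?U" for E
  proof -
    obtain N where N: "E \<subseteq> X" "\<forall>n\<in>S. N \<le> n \<longrightarrow> (\<exists>M. \<forall>m\<in>UNIV. M \<le> m \<longrightarrow> p n \<cdot> p m \<in> E)"
      using E by (auto simp: mem_tail_star_tail[OF inf infU p])
    have le: "N \<le> N * k" using k by simp
    obtain M where M: "\<forall>m. M \<le> m \<longrightarrow> p (N * k) \<cdot> p m \<in> E"
      using N(2)[rule_format, OF S1 le] by auto
    have "p n \<in> E" if n: "N * k + 1 + M \<le> n" for n
      using M[rule_format, of "n - (N * k + 1)"] n by (simp add: pm)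
    then show ?thesis using N(1) by (auto simp: mem_tail_family)
  qed
  have "?A \<star> ?A = ?U"
    by (rule set_eqI, rule iffI, erule AA, erule big[OF inf inf])
  moreover have "?A \<star> ?U = ?U"
    by (rule set_eqI, rule iffI, erule AU, erule big[OF inf infU])
  ultimately have "?U = ?A"
    using sub_clifford_cube_eq_square[OF sub tail_family_in_N2[OF inf, of X p]] by simp
  moreover have "p ` S \<in> ?A" using p by (auto simp: mem_tail_family)
  ultimately have "p ` S \<in> ?U" by simp
  then obtain N where N: "\<forall>n\<ge>N. p n \<in> p ` S" by (auto simp: mem_tail_family)
  \<comment> \<open>An index beyond \<open>N\<close> with exponent \<open>Suc N * k\<close>; by
    \<open>inj\<close> its power cannot equal one indexed by \<open>S\<close>.\<close>
  define n where "n = N * k + (k - 1)"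
  have "Suc n = Suc N * k" using k by (simp add: n_def)
  then have n: "Suc n mod k = 0" by simp
  have "N \<le> N * k" using k by simp
  then have "N \<le> n" unfolding n_def by (rule trans_le_add1)
  then have "p n \<in> p ` S" using N by simp
  then obtain m where m: "m \<in> S" "p n = p m" by auto
  have "n mod k = m mod k" by (rule inj[OF m(2)[unfolded p_def]])
  then have "Suc m mod k = 0" using n by (metis mod_Suc_eq)
  then show False using m by (simp add: S_def)
qed

text \<open>If the cube differs from \<open>x\<close>, then all \<open>d\<close> with
  \<open>power_seq x d = x\<close> are multiples of some \<open>k \<ge> 3\<close>: either only zero
  occurs, or \<open>k\<close> is the least positive one. By cancellation any two equal powers have
  indices congruent modulo \<open>k\<close>, which \<open>sub_clifford_no_period\<close>
  forbids.\<close>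

lemma sub_clifford_cube:
  assumes sub: "sub_clifford_on (N2 X) (ext_op X f)" and x: "x \<in> X"
  shows "x \<cdot> x \<cdot> x = x"
proof (rule ccontr)
  let ?p = "power_seq x"
  assume "x \<cdot> x \<cdot> x \<noteq> x"
  then have p2: "?p 2 \<noteq> ?p 0" and p1: "?p 1 \<noteq> ?p 0"
    using x by (auto simp: power_seq_Suc numeral_2_eq_2 assoc)
  have diff: "?p (j - i) = ?p 0" if "?p i = ?p j" "i \<le> j" for i j
    using sub_clifford_power_cancel[OF sub x, of "j - i" i 0] that by simp
  have "\<exists>k\<ge>3. \<forall>d. ?p d = ?p 0 \<longrightarrow> d mod k = 0"
  proof (cases "\<exists>d>0. ?p d = ?p 0")
    case False
    then have "\<forall>d. ?p d = ?p 0 \<longrightarrow> d mod 3 = 0" by (metis mod_0 neq0_conv)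
    then show ?thesis by (intro exI[of _ 3]) simp
  next
    case True
    define k where "k = (LEAST d. d > 0 \<and> ?p d = ?p 0)"
    have k: "k > 0" "?p k = ?p 0" using LeastI_ex[OF True] by (auto simp: k_def)
    have least: "d = 0" if "d < k" "?p d = ?p 0" for d
      using not_less_Least[of d "\<lambda>d. d > 0 \<and> ?p d = ?p 0"] that by (auto simp: k_def)
    have per: "?p (n + k) = ?p n" for n
    proof (cases n)
      case (Suc m)
      have "?p (n + k) = ?p k \<cdot> ?p m" using x Suc by (simp add: power_seq_mult add.commute)
      also have "\<dots> = ?p n" using k Suc by (simp add: power_seq_Suc)
      finally show ?thesis .
    qed (use k in simp)
    have per': "?p (n + q * k) = ?p n" for n q
    proof (induction q)
      case (Suc q)
      then show ?case using per[of "n + q * k"] by (simp add: algebra_simps)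
    qed simp
    \<comment> \<open>By periodicity the remainder of \<open>d\<close> is again a return index, and
      it lies below the least positive one.\<close>
    have "d mod k = 0" if "?p d = ?p 0" for d
      using least[of "d mod k"] k per'[of "d mod k" "d div k"] that by simp
    moreover have "k \<ge> 3"
    proof (rule ccontr)
      assume "\<not> 3 \<le> k"
      then have "k = 1 \<or> k = 2" using k by auto
      then show False using k p1 p2 by auto
    qed
    ultimately show ?thesis by blast
  qed
  then obtain k where k: "k \<ge> 3" "\<And>d. ?p d = ?p 0 \<Longrightarrow> d mod k = 0" by blast
  have *: "i mod k = j mod k" if "?p i = ?p j" "i \<le> j" for i j
    using k(2)[OF diff[OF that]] that(2) by (metis mod_0_imp_dvd mod_eq_dvd_iff_nat)
  have "i mod k = j mod k" if "?p i = ?p j" for i j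
  proof (cases "i \<le> j")
    case False
    then show ?thesis using *[OF that[symmetric]] by simp
  qed (rule *[OF that])
  then show False by (rule sub_clifford_no_period[OF sub x k(1)])
qed


subsection \<open>The structure of the carrier\<close>

context
  assumes idem_comm: "idempotents_commute_on (N2 X) (ext_op X f)"
    and sub_or_reg: "sub_clifford_on (N2 X) (ext_op X f) \<or> regular_on (N2 X) (ext_op X f)"
begin

lemma star_idempotents_commute:
  "\<A> \<in> N2 X \<Longrightarrow> \<B> \<in> N2 X \<Longrightarrow> \<A> \<star> \<A> = \<A> \<Longrightarrow> \<B> \<star> \<B> = \<B> \<Longrightarrow> \<A> \<star> \<B> = \<B> \<star> \<A>"
  using idem_comm unfolding idempotents_commute_on_def by blast

lemma idempotents_commute:
  assumes "e \<in> X" "h \<in> X" "e \<cdot> e = e" "h \<cdot> h = h"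
  shows "e \<cdot> h = h \<cdot> e"
proof -
  have "principal_family X {e \<cdot> h} = principal_family X {h \<cdot> e}"
    using star_idempotents_commute[of "principal_family X {e}" "principal_family X {h}"] assms
    by (simp add: principal_in_N2 principal_singleton_star)
  then show ?thesis using principal_inj[of "{e \<cdot> h}" X "{h \<cdot> e}"] assms by simp
qed

text \<open>\<open>F = {e, h}\<close> has \<open>FF = FFF = {e, eh, h}\<close>, which settles the
  sub-Clifford case. In the regular case \<open>ebe\<close> and \<open>ebh\<close> lie in
  \<open>F\<close> and are fixed by \<open>e\<close> on the left; if \<open>eh \<noteq> h\<close>,
  both equal \<open>e\<close>, and \<open>e = ebh = ebhh = eh\<close>.\<close>

lemma idempotents_chain:
  assumes e: "e \<in> X" "e \<cdot> e = e" and h: "h \<in> X" "h \<cdot> h = h"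
  shows "e \<cdot> h = e \<or> e \<cdot> h = h"
proof (rule ccontr)
  assume ne: "\<not> ?thesis"
  have he: "h \<cdot> e = e \<cdot> h" using idempotents_commute e h by simp
  have e1: "e \<cdot> (e \<cdot> h) = e \<cdot> h" using assoc[of e e h] e h by simp
  have h1: "h \<cdot> (e \<cdot> h) = e \<cdot> h" using assoc[of h e h] assoc[of e h h] e h he by simp
  show False
    using sub_or_reg
  proof
    assume "sub_clifford_on (N2 X) (ext_op X f)"
    then have "{e, e \<cdot> h, h} = {e, h}"
      by (rule sub_clifford_principal) (use e h he e1 h1 in auto)
    then show False using ne by auto
  next
    assume "regular_on (N2 X) (ext_op X f)"
    from regular_principal[OF this, of "{e, h}" e e] obtain b where b: "b \<in> X"
        "e \<cdot> b \<cdot> e \<in> {e, h}" "e \<cdot> b \<cdot> h \<in> {e, h}"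
      using e h by auto
    have 1: "e \<cdot> (e \<cdot> b \<cdot> e) = e \<cdot> b \<cdot> e" "e \<cdot> (e \<cdot> b \<cdot> h) = e \<cdot> b \<cdot> h"
      using assoc[of e e b] b(1) e h by (simp_all flip: assoc)
    have "e \<cdot> b \<cdot> e = e" "e \<cdot> b \<cdot> h = e" using b 1 ne by auto
    then have "e \<cdot> h = e" using assoc[of "e \<cdot> b" h h] b(1) e h by simp
    then show False using ne by simp
  qed
qed

text \<open>The \<open>b\<close> obtained for \<open>{u, x}\<close> has \<open>ubu\<close> equal to
  \<open>u\<close> or \<open>x\<close>, and then \<open>xx = xbx\<close> or \<open>xx = ubx\<close>,
  respectively. So \<open>xx\<close> is \<open>u\<close> or \<open>x\<close>, and either gives the
  cube.\<close>

lemma regular_cube: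
  assumes reg: "regular_on (N2 X) (ext_op X f)" and u: "u \<in> X" "u \<cdot> u = u" and x: "x \<in> X"
    and ux: "u \<cdot> x = x" "x \<cdot> u = x"
  shows "x \<cdot> x \<cdot> x = x"
proof -
  from regular_principal[OF reg, of "{u, x}" u x] obtain b where b: "b \<in> X"
      "u \<cdot> b \<cdot> u \<in> {u, x}" "u \<cdot> b \<cdot> x \<in> {u, x}" "x \<cdot> b \<cdot> u \<in> {u, x}" "x \<cdot> b \<cdot> x \<in> {u, x}"
    using u x by auto
  have 1: "u \<cdot> b \<cdot> u \<cdot> x = u \<cdot> b \<cdot> x" using assoc[of "u \<cdot> b" u x] u x b(1) ux by simp
  have 2: "x \<cdot> (u \<cdot> b \<cdot> u) = x \<cdot> b \<cdot> u"
    using assoc[of x u "b \<cdot> u"] u x b(1) ux by (simp add: assoc)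
  from b(2) have "x \<cdot> x \<in> {u, x}"
  proof
    assume "u \<cdot> b \<cdot> u = u"
    then have "x \<cdot> b \<cdot> u = x" "u \<cdot> b \<cdot> x = x" using 1 2 ux by auto
    moreover have "x \<cdot> x = x \<cdot> b \<cdot> x"
      using calculation assoc[of "x \<cdot> b" u x] u x b(1) ux by simp
    ultimately show ?thesis using b(5) by simp
  next
    assume "u \<cdot> b \<cdot> u \<in> {x}"
    then show ?thesis using 1 b(3) by simp
  qed
  then show ?thesis using ux by auto
qed

text \<open>In the regular case \<open>x = xyx\<close> gives a left unit \<open>xy\<close> and a
  right unit \<open>yx\<close> of \<open>x\<close>, both idempotent. They are comparable, so the
  larger one is a two-sided unit of \<open>x\<close> and \<open>regular_cube\<close>
  applies.\<close>

lemma cube: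
  assumes x: "x \<in> X"
  shows "x \<cdot> x \<cdot> x = x"
  using sub_or_reg
proof
  assume "sub_clifford_on (N2 X) (ext_op X f)"
  then show ?thesis using sub_clifford_cube x by blast
next
  assume reg: "regular_on (N2 X) (ext_op X f)"
  from regular_principal[OF reg, of "{x}" x x] obtain y where y: "y \<in> X" "x \<cdot> y \<cdot> x = x"
    using x by auto
  have e: "x \<cdot> y \<in> X" "x \<cdot> y \<cdot> (x \<cdot> y) = x \<cdot> y" using x y assoc[of "x \<cdot> y" x y] by auto
  have h: "y \<cdot> x \<in> X" "y \<cdot> x \<cdot> (y \<cdot> x) = y \<cdot> x"
    using x y by (auto simp: assoc)
  have xh: "x \<cdot> (y \<cdot> x) = x" using x y by (simp add: assoc)
  from idempotents_chain[OF e h] show ?thesis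
  proof
    assume "x \<cdot> y \<cdot> (y \<cdot> x) = x \<cdot> y"
    then have "y \<cdot> x \<cdot> (x \<cdot> y) = x \<cdot> y" using idempotents_commute[OF e(1) h(1) e(2) h(2)] by simp
    then have "y \<cdot> x \<cdot> x = x" using assoc[of "y \<cdot> x" "x \<cdot> y" x] e h x y by simp
    then show ?thesis using regular_cube[OF reg h x _ xh] by simp
  next
    assume "x \<cdot> y \<cdot> (y \<cdot> x) = y \<cdot> x"
    then have "y \<cdot> x \<cdot> (x \<cdot> y) = y \<cdot> x" using idempotents_commute[OF e(1) h(1) e(2) h(2)] by simp
    then have "x \<cdot> (x \<cdot> y) = x" using assoc[of x "y \<cdot> x" "x \<cdot> y"] e h x xh by simp
    then show ?thesis using regular_cube[OF reg e x y(2)] by simp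
  qed
qed

section \<open>Elements that are not idempotent\<close>

text \<open>\<open>F = {g, h}\<close> has \<open>FF = FFF = {e, g, h}\<close>. In the regular case
  \<open>hbh\<close> is \<open>g\<close> or \<open>h\<close>; then \<open>hbg\<close> or
  \<open>gbg\<close>, respectively, equals \<open>e\<close>, which is outside
  \<open>F\<close>.\<close>

lemma no_unit_above_involution:
  assumes X: "g \<in> X" "e \<in> X" "h \<in> X" and ge: "g \<cdot> g = e" "e \<cdot> g = g" "g \<cdot> e = g" "g \<noteq> e"
    and h: "h \<cdot> h = h" "e \<cdot> h = e" "h \<cdot> e = e" "h \<noteq> e"
  shows False
proof -
  have hg: "h \<cdot> g = g" "g \<cdot> h = g" using assoc[of h e g] assoc[of g e h] X ge h by auto
  have ee: "e \<cdot> e = e" using assoc[of e g g] X ge by simp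
  have gh: "g \<noteq> h" using ge h by auto
  show False
    using sub_or_reg
  proof
    assume "sub_clifford_on (N2 X) (ext_op X f)"
    then have "{e, g, h} = {g, h}"
      by (rule sub_clifford_principal) (use X ge h hg in auto)
    then show False using ge h by auto
  next
    assume "regular_on (N2 X) (ext_op X f)"
    from regular_principal[OF this, of "{g, h}" g h] obtain b where b: "b \<in> X"
        "h \<cdot> b \<cdot> h \<in> {g, h}" "h \<cdot> b \<cdot> g \<in> {g, h}" "g \<cdot> b \<cdot> g \<in> {g, h}"
      using X by auto
    have 1: "h \<cdot> b \<cdot> h \<cdot> g = h \<cdot> b \<cdot> g" "g \<cdot> (h \<cdot> b \<cdot> h) \<cdot> g = g \<cdot> b \<cdot> g"
      using X b(1) hg assoc[of g h b] by (simp_all add: assoc flip: assoc[of g h])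
    from b(2) have "h \<cdot> b \<cdot> h = g \<or> h \<cdot> b \<cdot> h = h" by blast
    then show False
    proof
      assume "h \<cdot> b \<cdot> h = g"
      then show False using 1 b(3) ge h by auto
    next
      assume "h \<cdot> b \<cdot> h = h"
      then show False using 1 b(4) ge h hg by auto
    qed
  qed
qed

text \<open>The idempotent families generated by \<open>{e, g}\<close> and by \<open>{e, h}\<close>,
  \<open>{g, h}\<close> do not commute. In \<open>?A \<star> ?C\<close> the member of
  \<open>?C\<close> may vary with the left factor: \<open>e{e, h} = g{g, h} = {e, h}\<close>. But
  every set in \<open>?C \<star> ?A\<close> contains \<open>g\<close>.\<close>

lemma no_zero_below_involution:
  assumes X: "g \<in> X" "e \<in> X" "h \<in> X" and ge: "g \<cdot> g = e" "e \<cdot> g = g" "g \<cdot> e = g" "g \<noteq> e"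
    and h: "h \<cdot> h = h" "e \<cdot> h = h" "h \<cdot> e = h" "h \<noteq> e" "g \<cdot> h = h" "h \<cdot> g = h"
  shows False
proof -
  have ee: "e \<cdot> e = e" using assoc[of e g g] X ge by simp
  have gh: "g \<noteq> h" using ge h by auto
  let ?A = "principal_family X {e, g}"
  let ?C = "principal_family X {e, h} \<union> principal_family X {g, h}"
  have A: "?A \<in> N2 X" by (simp add: principal_in_N2)
  have C: "?C \<in> N2 X"
    unfolding N2_def upfamily_def linked_def principal_family_def by blast
  have AA: "?A \<star> ?A = ?A"
    using X ge ee by (simp add: principal_star insert_commute)
  have mC: "{b \<in> X. P b} \<in> ?C \<longleftrightarrow> P h \<and> (P e \<or> P g)" for P
    using X by (auto simp: mem_principal)
  have mA: "{b \<in> X. P b} \<in> ?A \<longleftrightarrow> P e \<and> P g" for P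
    using X by (auto simp: mem_principal)
  have CC: "?C \<star> ?C = ?C"
    using X ge ee h
    by (intro set_eqI) (auto simp: mem_star_iff[OF N2D(1)[OF C] N2D(1)[OF C]] mC
        simp del: Un_iff, auto simp: mem_principal)
  have "{e, h} \<in> ?A \<star> ?C"
    using X ge ee h
    by (simp add: mem_star_iff[OF N2D(1)[OF A] N2D(1)[OF C]] mC mA del: Un_iff)
  moreover have "{e, h} \<notin> ?C \<star> ?A"
    using X ge ee h gh
    by (simp add: mem_star_iff[OF N2D(1)[OF C] N2D(1)[OF A]] mC mA del: Un_iff)
  ultimately show False using star_idempotents_commute[OF A C AA CC] by simp
qed

text \<open>Let \<open>e = gg\<close>. If \<open>h\<close> lies above \<open>e\<close>,
  \<open>no_unit_above_involution\<close> applies. If below, \<open>h\<close> equals its conjugate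
  \<open>ghg\<close>, so \<open>g\<close> commutes with \<open>h\<close>. Then \<open>k = gh\<close>
  either equals \<open>h\<close>, so that \<open>h\<close> is a zero for \<open>g\<close>, or is an
  involution over \<open>h\<close> with the unit \<open>e\<close> above it.\<close>

lemma involution_unique_idempotent:
  assumes g: "g \<in> X" "g \<cdot> g \<noteq> g" and h: "h \<in> X" "h \<cdot> h = h"
  shows "h = g \<cdot> g"
proof (rule ccontr)
  define e where "e = g \<cdot> g"
  assume "h \<noteq> g \<cdot> g"
  then have he: "h \<noteq> e" by (simp add: e_def)
  have e: "e \<in> X" using g by (simp add: e_def)
  have ge: "g \<cdot> g = e" "e \<cdot> g = g" "g \<cdot> e = g" "g \<noteq> e"
    using g cube[OF g(1)] by (auto simp: e_def assoc)
  have ee: "e \<cdot> e = e" using assoc[of e g g] g e ge by simp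
  have comm: "e \<cdot> h = h \<cdot> e" using idempotents_commute e ee h by simp
  from idempotents_chain[OF e ee h] show False
  proof
    assume "e \<cdot> h = e"
    then show False
      using no_unit_above_involution[OF g(1) e h(1) ge h(2)] comm he by simp
  next
    assume eh: "e \<cdot> h = h"
    then have he': "h \<cdot> e = h" using comm by simp
    define j where "j = g \<cdot> h \<cdot> g"
    have j: "j \<in> X" using g h by (simp add: j_def)
    have gj: "g \<cdot> j = h \<cdot> g" "j \<cdot> g = g \<cdot> h" "g \<cdot> j \<cdot> g = h"
      using g h e ge eh he' assoc[of g g "h \<cdot> g"] assoc[of e h g] assoc[of h g g]
      by (simp_all add: j_def assoc)
    have jj: "j \<cdot> j = j"
    proof -
      have "j \<cdot> j = g \<cdot> h \<cdot> (g \<cdot> j)" using g h j by (simp add: j_def assoc)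
      also have "\<dots> = g \<cdot> (h \<cdot> (h \<cdot> g))" using gj g h by (simp add: assoc)
      also have "\<dots> = j" using assoc[of h h g] g h by (simp add: j_def assoc)
      finally show ?thesis .
    qed
    have conj: "g \<cdot> (j \<cdot> h) \<cdot> g = h \<cdot> j"
    proof -
      have "g \<cdot> (j \<cdot> h) \<cdot> g = g \<cdot> j \<cdot> (h \<cdot> g)" using g h j by (simp add: assoc)
      also have "\<dots> = h \<cdot> (g \<cdot> (h \<cdot> g))" using gj g h by (simp add: assoc)
      finally show ?thesis using g h by (simp add: j_def assoc)
    qed
    have jh: "j \<cdot> h = h \<cdot> j" using idempotents_commute j jj h by simp
    \<comment> \<open>Conjugation by \<open>g\<close> interchanges \<open>j\<close> and
      \<open>h\<close> and fixes \<open>jh\<close>. Since \<open>jh\<close> is one of them, they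
      coincide.\<close>
    have "j = h"
      using idempotents_chain[OF j jj h] conj gj(3) jh j_def by metis
    then have gh: "g \<cdot> h = h \<cdot> g" using gj by simp
    define k where "k = g \<cdot> h"
    have k: "k \<in> X" using g h by (simp add: k_def)
    have kh: "k \<cdot> h = k" "h \<cdot> k = k"
      using g h assoc[of g h h] assoc[of h h g] by (simp_all add: k_def) (simp_all add: gh)
    have kk: "k \<cdot> k = h"
    proof -
      have "k \<cdot> k = g \<cdot> (h \<cdot> k)" using g h k by (simp add: k_def assoc)
      also have "\<dots> = g \<cdot> g \<cdot> h" unfolding kh using g h by (simp add: k_def assoc)
      finally show ?thesis using ge eh by simp
    qed
    show False
    proof (cases "k = h")
      case True
      then show False
        using no_zero_below_involution[OF g(1) e h(1) ge h(2) eh he' he] gh by (simp add: k_def)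
    next
      case False
      then show False
        using no_unit_above_involution[OF k h(1) e kk kh(2,1) False ee he' eh] he by simp
    qed
  qed
qed

text \<open>All squares are idempotent, hence equal to \<open>e = gg\<close>, so \<open>X\<close> is
  a group of exponent two. A third element \<open>b\<close> gives \<open>c = gb\<close>, and
  \<open>F = {e, g, b}\<close> misses \<open>c\<close> while \<open>FF\<close> contains it. In the
  regular case \<open>d\<close> lies in \<open>F\<close>, and for \<open>d = e\<close>,
  \<open>g\<close>, \<open>b\<close> the element \<open>gdb\<close>, \<open>db\<close>,
  \<open>dg\<close>, respectively, is \<open>c\<close>.\<close>

lemma involution_two_elements:
  assumes g: "g \<in> X" "g \<cdot> g \<noteq> g"
  shows "X = {g \<cdot> g, g}"
proof (rule ccontr)
  define e where "e = g \<cdot> g"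
  have e: "e \<in> X" using g by (simp add: e_def)
  have sq: "x \<cdot> x = e" if x: "x \<in> X" for x
  proof -
    have "x \<cdot> x \<cdot> (x \<cdot> x) = x \<cdot> x" using cube[OF x] assoc[of "x \<cdot> x" x x] x by simp
    then show ?thesis using involution_unique_idempotent[OF g, of "x \<cdot> x"] x by (simp add: e_def)
  qed
  have unit: "e \<cdot> x = x" "x \<cdot> e = x" if x: "x \<in> X" for x
    using cube[OF x] sq[OF x] assoc[of x x x] x by auto
  assume "X \<noteq> {g \<cdot> g, g}"
  then obtain b where b: "b \<in> X" "b \<noteq> e" "b \<noteq> g" using g e by (auto simp: e_def)
  have gne: "g \<noteq> e" using g by (auto simp: e_def)
  define c where "c = g \<cdot> b"
  have c: "c \<in> X" using g b by (simp add: c_def)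
  have gc: "g \<cdot> c = b" using assoc[of g g b] g b sq unit by (simp add: c_def)
  have cb: "c \<cdot> b = g" using assoc[of g b b] g b sq unit by (simp add: c_def)
  have bg: "b \<cdot> g = c"
  proof -
    have "b \<cdot> g = g \<cdot> c \<cdot> (c \<cdot> b)" by (simp add: gc cb)
    also have "\<dots> = g \<cdot> (c \<cdot> c \<cdot> b)" using g b c by (simp add: assoc)
    finally show ?thesis using sq unit b c by (simp add: c_def)
  qed
  have bc: "b \<cdot> c = g" using bg assoc[of b b g] g b sq unit by simp
  have cne: "c \<noteq> e" "c \<noteq> g" "c \<noteq> b"
  proof -
    show "c \<noteq> e" using gc unit g b by auto
    show "c \<noteq> g" using gc sq g b by auto
    show "c \<noteq> b" using cb sq g b gne by auto
  qed
  show False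
    using sub_or_reg
  proof
    assume "sub_clifford_on (N2 X) (ext_op X f)"
    then have "{e, g, b, c} = {e, g, b}"
      by (rule sub_clifford_principal) (use g b c e sq unit bg gc bc c_def[symmetric] in auto)
    then show False using cne by auto
  next
    assume "regular_on (N2 X) (ext_op X f)"
    from regular_principal[OF this, of "{e, g, b}" e g] obtain d where d: "d \<in> X"
        "e \<cdot> d \<cdot> e \<in> {e, g, b}" "e \<cdot> d \<cdot> g \<in> {e, g, b}" "e \<cdot> d \<cdot> b \<in> {e, g, b}" "g \<cdot> d \<cdot> b \<in> {e, g, b}"
      using g b e by auto
    then have "d \<in> {e, g, b}" "d \<cdot> g \<in> {e, g, b}" "d \<cdot> b \<in> {e, g, b}" "g \<cdot> d \<cdot> b \<in> {e, g, b}"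
      using unit by auto
    then show False using cne bg g unit c_def by auto
  qed
qed

text \<open>Tail filters along a monotone sequence multiply as left zeros or as right zeros. All of
  them are then idempotent, and those of the even and of the odd indices cannot commute, being
  distinct.\<close>

lemma chain_finite:
  assumes idem: "\<And>x. x \<in> X \<Longrightarrow> x \<cdot> x = x"
  shows "finite X"
proof (rule ccontr)
  assume "infinite X"
  then obtain s :: "nat \<Rightarrow> 'a" where s: "inj s" "range s \<subseteq> X"
    using infinite_countable_subset by blast
  have sX: "s n \<in> X" for n using s by auto
  \<comment> \<open>The colour records whether the term with the smaller index is the smaller one;
    \<open>Min\<close> and \<open>Max\<close> order the unordered pair. A homogeneous set is a
    monotone subsequence.\<close>
  define col where "col A = (if s (Min A) \<cdot> s (Max A) = s (Min A) then 0 else 1 :: nat)" for A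
  have col_less: "col A < 2" for A by (simp add: col_def)
  obtain Y t where Y: "infinite Y" "\<forall>x\<in>Y. \<forall>y\<in>Y. x \<noteq> y \<longrightarrow> col {x, y} = t"
    using Ramsey2[OF infinite_UNIV_nat, of col 2] by (auto simp: col_less)
  define r where "r = enumerate Y"
  have r: "strict_mono r" "r n \<in> Y" for n
    using Y by (auto simp: r_def strict_mono_enumerate enumerate_in_set)
  define p where "p = s \<circ> r"
  have pX: "p n \<in> X" and pR: "range p \<subseteq> X" for n using sX by (auto simp: p_def)
  have pinj: "inj p"
    unfolding p_def using s(1) strict_mono_imp_inj_on[OF r(1)] by (rule inj_compose)
  have col: "col {r i, r j} = t" if "i < j" for i j
    using Y(2) r that by (metis strict_mono_less less_irrefl)
  have col': "col {r i, r j} = (if p i \<cdot> p j = p i then 0 else 1)" if "i < j" for i j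
    using strict_mono_less[OF r(1), of i j] that by (simp add: col_def p_def)
  have "(\<forall>i j. i \<le> j \<longrightarrow> p i \<cdot> p j = p i) \<or> (\<forall>i j. i \<le> j \<longrightarrow> p i \<cdot> p j = p j)"
  proof (cases "t = 0")
    case True
    then have "p i \<cdot> p j = p i" if "i \<le> j" for i j
      using col[of i j] col'[of i j] idem[OF pX[of i]] that
      by (cases "i = j") (auto split: if_splits)
    then show ?thesis by blast
  next
    case False
    then have "p i \<cdot> p j = p j" if "i \<le> j" for i j
      using col[of i j] col'[of i j] idem[OF pX] idempotents_chain[of "p i" "p j"] pX that
      by (cases "i = j") (auto split: if_splits)
    then show ?thesis by blast
  qed
  \<comment> \<open>If the sequence increases, the inner limit returns \<open>p n\<close> and the
    first factor survives. If it decreases, the inner condition is free of \<open>n\<close> and the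
    second factor survives.\<close>
  then have star: "(\<forall>S R. infinite S \<longrightarrow> infinite R \<longrightarrow>
        tail_family X p S \<star> tail_family X p R = tail_family X p S) \<or>
      (\<forall>S R. infinite S \<longrightarrow> infinite R \<longrightarrow>
        tail_family X p S \<star> tail_family X p R = tail_family X p R)"
  proof
    assume asc: "\<forall>i j. i \<le> j \<longrightarrow> p i \<cdot> p j = p i"
    have "(\<exists>M. \<forall>m\<in>R. M \<le> m \<longrightarrow> p n \<cdot> p m \<in> E) \<longleftrightarrow> p n \<in> E" if R: "infinite R" for R n E
    proof
      assume "\<exists>M. \<forall>m\<in>R. M \<le> m \<longrightarrow> p n \<cdot> p m \<in> E"
      then obtain M where M: "\<forall>m\<in>R. M \<le> m \<longrightarrow> p n \<cdot> p m \<in> E" ..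
      obtain m where "m \<in> R" "max M n \<le> m"
        using R unfolding infinite_nat_iff_unbounded_le by blast
      then show "p n \<in> E" using M asc by (metis max.bounded_iff)
    qed (use asc in metis)
    then show ?thesis
      by (intro disjI1 allI impI set_eqI) (simp add: mem_tail_star_tail pR mem_tail_family)
  next
    assume desc: "\<forall>i j. i \<le> j \<longrightarrow> p i \<cdot> p j = p j"
    have "(\<exists>M. \<forall>m\<in>R. M \<le> m \<longrightarrow> p n \<cdot> p m \<in> E) \<longleftrightarrow> (\<exists>M. \<forall>m\<in>R. M \<le> m \<longrightarrow> p m \<in> E)" for R n E
    proof
      assume "\<exists>M. \<forall>m\<in>R. M \<le> m \<longrightarrow> p n \<cdot> p m \<in> E"
      then obtain M where M: "\<forall>m\<in>R. M \<le> m \<longrightarrow> p n \<cdot> p m \<in> E" ..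
      then have "\<forall>m\<in>R. max M n \<le> m \<longrightarrow> p m \<in> E" using desc by (metis max.bounded_iff)
      then show "\<exists>M. \<forall>m\<in>R. M \<le> m \<longrightarrow> p m \<in> E" ..
    next
      assume "\<exists>M. \<forall>m\<in>R. M \<le> m \<longrightarrow> p m \<in> E"
      then obtain M where M: "\<forall>m\<in>R. M \<le> m \<longrightarrow> p m \<in> E" ..
      then have "\<forall>m\<in>R. max M n \<le> m \<longrightarrow> p n \<cdot> p m \<in> E" using desc by (metis max.bounded_iff)
      then show "\<exists>M. \<forall>m\<in>R. M \<le> m \<longrightarrow> p n \<cdot> p m \<in> E" ..
    qed
    moreover have "(\<exists>N. \<forall>n\<in>S. N \<le> n \<longrightarrow> P) \<longleftrightarrow> P" if S: "infinite S" for S :: "nat set" and P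
      using S unfolding infinite_nat_iff_unbounded_le by metis
    ultimately show ?thesis
      by (intro disjI2 allI impI set_eqI) (simp add: mem_tail_star_tail pR mem_tail_family)
  qed
  define S0 S1 where "S0 = {n :: nat. even n}" and "S1 = {n :: nat. odd n}"
  have inf: "infinite S0" "infinite S1"
    unfolding infinite_nat_iff_unbounded_le S0_def S1_def
    by (intro allI, rule_tac x = "2 * m" in exI, simp, intro allI, rule_tac x = "2 * m + 1" in exI, simp)
  let ?A = "tail_family X p S0" and ?B = "tail_family X p S1"
  have "?A \<star> ?A = ?A" "?B \<star> ?B = ?B" using star inf by blast+
  then have "?A \<star> ?B = ?B \<star> ?A"
    by (rule star_idempotents_commute[OF tail_family_in_N2[OF inf(1)] tail_family_in_N2[OF inf(2)]])
  then have "?A = ?B" using star inf by metis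
  moreover have "p ` S0 \<in> ?A" using pX by (auto simp: mem_tail_family)
  ultimately have "p ` S0 \<in> ?B" by simp
  then obtain N where "\<forall>n\<in>S1. N \<le> n \<longrightarrow> p n \<in> p ` S0" by (auto simp: mem_tail_family)
  then have "p (2 * N + 1) \<in> p ` S0" by (simp add: S1_def)
  then have "2 * N + 1 \<in> S0" using pinj by (simp add: inj_image_mem_iff)
  then show False by (simp add: S0_def)
qed

end

subsection \<open>Finite chains and the two-element group\<close>

text \<open>The isomorphism is the rank, the number of elements strictly below \<open>x\<close> in
  the order \<open>y \<le> x\<close> iff \<open>yx = y\<close>. It is strictly monotone, hence
  injective, and counting gives its image.\<close>

lemma finite_chain_iso:
  assumes fin: "finite X" and idem: "\<And>x. x \<in> X \<Longrightarrow> x \<cdot> x = x"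
    and comm: "\<And>x y. x \<in> X \<Longrightarrow> y \<in> X \<Longrightarrow> x \<cdot> y = y \<cdot> x"
    and chain: "\<And>x y. x \<in> X \<Longrightarrow> y \<in> X \<Longrightarrow> x \<cdot> y = x \<or> x \<cdot> y = y"
  shows "semigroup_iso X f (L (card X)) min"
proof -
  define D where "D x = {y \<in> X. y \<cdot> x = y \<and> y \<noteq> x}" for x
  define h where "h x = card (D x)" for x
  have less: "h x < h y" if xy: "x \<in> X" "y \<in> X" "x \<cdot> y = x" "x \<noteq> y" for x y
  proof -
    have "D x \<subseteq> D y"
    proof
      fix z assume z: "z \<in> D x"
      then have zx: "z \<in> X" "z \<cdot> x = z" "z \<noteq> x" by (auto simp: D_def)
      have "z \<cdot> y = z" using assoc[of z x y] zx xy by simp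
      moreover have "z \<noteq> y" using zx xy comm[of x y] by auto
      ultimately show "z \<in> D y" using zx by (simp add: D_def)
    qed
    moreover have "x \<in> D y" "x \<notin> D x" using xy by (auto simp: D_def)
    moreover have "finite (D y)" using fin by (simp add: D_def)
    ultimately show ?thesis unfolding h_def by (intro psubset_card_mono) auto
  qed
  have "inj_on h X"
  proof (rule inj_onI, rule ccontr)
    fix x y assume "x \<in> X" "y \<in> X" "h x = h y" "x \<noteq> y"
    then show False using less[of x y] less[of y x] chain[of x y] comm[of x y] by auto
  qed
  moreover have "h ` X = {0..<card X}"
  proof (rule card_subset_eq)
    have "D x \<subset> X" if "x \<in> X" for x using that by (auto simp: D_def)
    then show "h ` X \<subseteq> {0..<card X}" unfolding h_def using psubset_card_mono[OF fin] by auto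
    show "card (h ` X) = card {0..<card X}" using calculation by (simp add: card_image)
  qed simp
  ultimately have "bij_betw h X (L (card X))" by (simp add: bij_betw_def L_def)
  moreover have "h (x \<cdot> y) = min (h x) (h y)" if "x \<in> X" "y \<in> X" for x y
  proof (cases "x = y")
    case False
    then show ?thesis
      using less[of x y] less[of y x] chain[OF that] comm[OF that] that by (auto simp: min_def)
  qed (use idem that in simp)
  ultimately show ?thesis unfolding semigroup_iso_def by blast
qed

lemma two_element_iso:
  assumes X: "X = {g \<cdot> g, g}" "g \<cdot> g \<noteq> g" and g: "g \<cdot> g \<cdot> g = g"
  shows "semigroup_iso X f (C 2) (*)"
proof -
  define e where "e = g \<cdot> g"
  have mult: "g \<cdot> g = e" "e \<cdot> g = g" "g \<cdot> e = g" "e \<cdot> e = e" "e \<noteq> g"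
    using X g assoc[of g g g] assoc[of "g \<cdot> g" g g] by (auto simp: e_def)
  define h where "h x = (if x = e then 1 else - 1 :: complex)" for x
  have C2: "C 2 = {1, - 1}" by (auto simp: C_def power2_eq_1_iff)
  have "bij_betw h X (C 2)"
    using mult X by (auto simp: bij_betw_def inj_on_def h_def C2 e_def)
  moreover have "\<forall>a\<in>X. \<forall>b\<in>X. h (a \<cdot> b) = h a * h b"
    using mult X by (auto simp: h_def e_def)
  ultimately show ?thesis unfolding semigroup_iso_def by blast
qed

text \<open>Over a finite chain the sets \<open>B a\<close> in the definition of the operation can be chosen
  independently of \<open>a\<close>, which makes the formula symmetric.\<close>

lemma mem_star_chain:
  assumes fin: "finite X" and h: "inj_on h X"
    and hf: "\<And>a b. a \<in> X \<Longrightarrow> b \<in> X \<Longrightarrow> h (a \<cdot> b) = min (h a) (h b :: nat)"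
    and A: "upfamily X \<A>" and B: "upfamily X \<B>"
  shows "E \<in> \<A> \<star> \<B> \<longleftrightarrow> E \<subseteq> X \<and> (\<exists>A\<in>\<A>. \<exists>B\<in>\<B>. \<forall>a\<in>A. \<forall>b\<in>B. a \<cdot> b \<in> E)"
proof
  have fl: "a \<cdot> b = a" if "a \<in> X" "b \<in> X" "h a \<le> h b" for a b
    using inj_onD[OF h, of "a \<cdot> b" a] hf[of a b] that by simp
  have fr: "a \<cdot> b = b" if "a \<in> X" "b \<in> X" "h b \<le> h a" for a b
    using inj_onD[OF h, of "a \<cdot> b" b] hf[of a b] that by simp
  assume "E \<in> \<A> \<star> \<B>"
  then obtain A where E: "E \<subseteq> X" and A': "A \<in> \<A>" "\<forall>a\<in>A. \<exists>B\<in>\<B>. f a ` B \<subseteq> E"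
    unfolding mem_ext_op by blast
  have AX: "A \<subseteq> X" and Ane: "A \<noteq> {}" using A A' unfolding upfamily_def by auto
  have BX: "B \<subseteq> X" if "B \<in> \<B>" for B using upfamily_sub[OF B that] .
  have "\<exists>B\<in>\<B>. \<forall>a\<in>A. \<forall>b\<in>B. a \<cdot> b \<in> E"
  proof (cases "\<exists>a\<in>A. \<exists>B\<in>\<B>. f a ` B \<subseteq> E \<and> (\<forall>b\<in>B. h b < h a)")
    case True
    define Q where "Q a \<longleftrightarrow> a \<in> A \<and> (\<exists>B\<in>\<B>. f a ` B \<subseteq> E \<and> (\<forall>b\<in>B. h b < h a))" for a
    have "\<exists>a. Q a" using True by (auto simp: Q_def)
    \<comment> \<open>Take the least such \<open>a0\<close>; its \<open>B0\<close> serves all of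
      \<open>A\<close>. If \<open>b \<le> a\<close>, then \<open>ab = b = a0 b\<close>. If
      \<open>a < b\<close>, then \<open>a < a0\<close>, so by minimality the member chosen for
      \<open>a\<close> reaches up to \<open>a\<close>, and \<open>ab = a\<close> lies in
      \<open>E\<close>.\<close>
    then obtain a0 where a0: "Q a0" "\<forall>a. Q a \<longrightarrow> h a0 \<le> h a"
      using ex_has_least_nat[of Q _ h] by blast
    then obtain B0 where B0: "B0 \<in> \<B>" "f a0 ` B0 \<subseteq> E" "\<forall>b\<in>B0. h b < h a0"
      by (auto simp: Q_def)
    have a0X: "a0 \<in> X" using a0 AX by (auto simp: Q_def)
    have BE: "b \<in> E" if "b \<in> B0" for b
      using fr[of a0 b] a0X BX[OF B0(1)] B0 that by (metis image_subset_iff less_imp_le subsetD)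
    have "a \<cdot> b \<in> E" if a: "a \<in> A" and b: "b \<in> B0" for a b
    proof -
      have abX: "a \<in> X" "b \<in> X" using a b AX BX[OF B0(1)] by blast+
      show ?thesis
      proof (cases "h b \<le> h a")
        case True
        then show ?thesis using fr[OF abX] BE[OF b] by simp
      next
        case False
        then have "h a < h a0" using B0(3) b by force
        then have "\<not> Q a" using a0(2) by (meson leD)
        then obtain B1 b1 where B1: "f a ` B1 \<subseteq> E" "B1 \<in> \<B>" "b1 \<in> B1" "h a \<le> h b1"
          using A'(2) a unfolding Q_def by (meson not_less)
        then have "a \<cdot> b1 = a" using fl[OF abX(1)] BX[OF B1(2)] by blast
        then have "a \<in> E" using B1 by (metis image_subset_iff)
        then show ?thesis using fl[OF abX] False by simp
      qed
    qed
    then show ?thesis using B0(1) by blast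
  next
    case False
    \<comment> \<open>Now every chosen member reaches up to its \<open>a\<close>, so
      \<open>A \<subseteq> E\<close>. The member \<open>Bm\<close> chosen for the greatest
      \<open>m\<close> in \<open>A\<close> serves all of \<open>A\<close>: for
      \<open>b < a \<le> m\<close> the product \<open>ab = b = mb\<close> lies in
      \<open>E\<close>.\<close>
    have finA: "finite (h ` A)" using fin AX finite_subset by blast
    have "Max (h ` A) \<in> h ` A" using Max_in[OF finA] Ane by simp
    then obtain m where m: "m \<in> A" "h m = Max (h ` A)" by (metis imageE)
    obtain Bm where Bm: "Bm \<in> \<B>" "f m ` Bm \<subseteq> E" using A'(2) m by blast
    have AE: "a \<in> E" if a: "a \<in> A" for a
    proof -
      obtain B1 where B1: "B1 \<in> \<B>" "f a ` B1 \<subseteq> E" using A'(2) a by blast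
      then obtain b1 where b1: "b1 \<in> B1" "h a \<le> h b1" using False a by (meson not_less)
      then have "a \<cdot> b1 = a" using fl a AX BX[OF B1(1)] by blast
      then show ?thesis using B1 b1 by (metis image_subset_iff)
    qed
    have "a \<cdot> b \<in> E" if a: "a \<in> A" and b: "b \<in> Bm" for a b
    proof -
      have abX: "a \<in> X" "b \<in> X" and mX: "m \<in> X" using a b m AX BX[OF Bm(1)] by blast+
      show ?thesis
      proof (cases "h a \<le> h b")
        case True
        then show ?thesis using fl[OF abX] AE[OF a] by simp
      next
        case False
        have "h a \<le> h m" using m(2) finA a by simp
        then have "m \<cdot> b = b" "a \<cdot> b = b"
          using fr[OF mX abX(2)] fr[OF abX] False by auto
        moreover have "m \<cdot> b \<in> E" using Bm b by auto
        ultimately show ?thesis by simp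
      qed
    qed
    then show ?thesis using Bm(1) by blast
  qed
  then show "E \<subseteq> X \<and> (\<exists>A\<in>\<A>. \<exists>B\<in>\<B>. \<forall>a\<in>A. \<forall>b\<in>B. a \<cdot> b \<in> E)" using E A' by blast
next
  assume "E \<subseteq> X \<and> (\<exists>A\<in>\<A>. \<exists>B\<in>\<B>. \<forall>a\<in>A. \<forall>b\<in>B. a \<cdot> b \<in> E)"
  then show "E \<in> \<A> \<star> \<B>" unfolding mem_ext_op image_subset_iff by metis
qed

text \<open>The formula of \<open>mem_star_chain\<close> is symmetric because the chain is
  commutative. It also makes every upfamily idempotent, so one-element sets serve as the
  subgroups.\<close>

lemma finite_chain_commutative_clifford:
  assumes iso: "semigroup_iso X f (L n) min"
  shows "commutative_on (N2 X) (ext_op X f) \<and> clifford_on (N2 X) (ext_op X f)"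
proof -
  obtain h where h: "bij_betw h X (L n)" and hf: "\<forall>a\<in>X. \<forall>b\<in>X. h (a \<cdot> b) = min (h a) (h b)"
    using iso unfolding semigroup_iso_def by blast
  have inj: "inj_on h X" and fin: "finite X"
    using h bij_betw_finite[OF h] by (auto simp: bij_betw_def L_def)
  have hf': "h (a \<cdot> b) = min (h a) (h b)" if "a \<in> X" "b \<in> X" for a b using hf that by blast
  note mem = mem_star_chain[OF fin inj hf']
  have comm: "a \<cdot> b = b \<cdot> a" if "a \<in> X" "b \<in> X" for a b
    using inj_onD[OF inj, of "a \<cdot> b" "b \<cdot> a"] hf' that by (simp add: min.commute)
  have fl: "a \<cdot> b = a" if "a \<in> X" "b \<in> X" "h a \<le> h b" for a b
    using inj_onD[OF inj, of "a \<cdot> b" a] hf'[of a b] that by simp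
  have sub: "E \<in> \<B> \<star> \<A>"
    if \<A>: "upfamily X \<A>" and \<B>: "upfamily X \<B>" and E: "E \<in> \<A> \<star> \<B>" for \<A> \<B> E
  proof -
    obtain A B where AB: "E \<subseteq> X" "A \<in> \<A>" "B \<in> \<B>" "\<forall>a\<in>A. \<forall>b\<in>B. a \<cdot> b \<in> E"
      using E mem[OF _ _ \<A> \<B>] by auto
    then have "\<forall>b\<in>B. \<forall>a\<in>A. b \<cdot> a \<in> E"
      using comm upfamily_sub[OF \<A> AB(2)] upfamily_sub[OF \<B> AB(3)] by (metis subsetD)
    then show ?thesis using mem[OF _ _ \<B> \<A>] AB by auto
  qed
  have idem: "\<A> \<star> \<A> = \<A>" if \<A>: "upfamily X \<A>" for \<A>
  proof (rule set_eqI, rule iffI)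
    fix E assume "E \<in> \<A> \<star> \<A>"
    then obtain A B where AB: "E \<subseteq> X" "A \<in> \<A>" "B \<in> \<A>" "\<forall>a\<in>A. \<forall>b\<in>B. a \<cdot> b \<in> E"
      using mem[OF _ _ \<A> \<A>] by auto
    \<comment> \<open>A greatest element \<open>b\<close> of \<open>B'\<close> acts as a unit on
      \<open>A'\<close>, so \<open>a = ab\<close> lies in \<open>E\<close>. Comparing the two maxima
      then decides which of \<open>A\<close>, \<open>B\<close> is contained in
      \<open>E\<close>.\<close>
    have *: "A' \<subseteq> E" if A': "A' \<in> \<A>" and B': "B' \<in> \<A>" and le: "Max (h ` A') \<le> Max (h ` B')"
      and E: "\<forall>a\<in>A'. \<forall>b\<in>B'. a \<cdot> b \<in> E" for A' B'
    proof
      fix a assume a: "a \<in> A'"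
      have X: "A' \<subseteq> X" "B' \<subseteq> X"
        using upfamily_sub[OF \<A> A'] upfamily_sub[OF \<A> B'] .
      have ne: "B' \<noteq> {}" using B' \<A> unfolding upfamily_def by blast
      have fins: "finite (h ` A')" "finite (h ` B')"
        using finite_subset[OF X(1) fin] finite_subset[OF X(2) fin] by simp_all
      have "Max (h ` B') \<in> h ` B'" using Max_in[OF fins(2)] ne by simp
      then obtain b where b: "b \<in> B'" "h b = Max (h ` B')" by (metis imageE)
      have "h a \<le> h b" using Max_ge[OF fins(1), of "h a"] a le b by simp
      then have "a \<cdot> b = a" using fl subsetD[OF X(1) a] subsetD[OF X(2) b(1)] by simp
      then show "a \<in> E" using E a b by metis
    qed
    have "\<forall>b\<in>B. \<forall>a\<in>A. b \<cdot> a \<in> E"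
      using AB comm upfamily_sub[OF \<A> AB(2)] upfamily_sub[OF \<A> AB(3)] by (metis subsetD)
    then have "A \<subseteq> E \<or> B \<subseteq> E"
      using *[OF AB(2,3)] *[OF AB(3,2)] AB(4) by linarith
    then show "E \<in> \<A>" using upfamily_mono[OF \<A>] AB by blast
  next
    fix E assume E: "E \<in> \<A>"
    then have X: "E \<subseteq> X" using upfamily_sub[OF \<A>] by blast
    have "a \<cdot> b \<in> E" if "a \<in> E" "b \<in> E" for a b
      using fl[of a b] fl[of b a] comm[of a b] subsetD[OF X] that by (cases "h a \<le> h b") auto
    then show "E \<in> \<A> \<star> \<A>" using mem[OF _ _ \<A> \<A>] E X by blast
  qed
  have "\<A> \<star> \<B> = \<B> \<star> \<A>" if "\<A> \<in> N2 X" "\<B> \<in> N2 X" for \<A> \<B>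
    using sub N2D(1)[OF that(1)] N2D(1)[OF that(2)] by (intro set_eqI iffI) metis+
  moreover have "subgroup_on {\<A>} (ext_op X f)" if "\<A> \<in> N2 X" for \<A>
    using idem[OF N2D(1)[OF that]] by (simp add: subgroup_on_def)
  ultimately show ?thesis
    unfolding commutative_on_def clifford_on_def by (meson empty_subsetI insert_subset singletonI)
qed

text \<open>The empty family is vacuously a linked upfamily. Any other one contains the whole set,
  and linkedness excludes having both singletons.\<close>

lemma N2_two_elements:
  assumes X: "X = {e, g}" "e \<noteq> g" and \<F>: "\<F> \<in> N2 X"
  shows "\<F> \<in> {{}, principal_family X {e}, principal_family X {g}, principal_family X {e, g}}"
proof -
  have up: "upfamily X \<F>" and li: "linked \<F>" using N2D[OF \<F>] by auto
  have sub: "\<F> \<subseteq> {{e}, {g}, {e, g}}" using up X unfolding upfamily_def by fastforce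
  have "\<not> ({e} \<in> \<F> \<and> {g} \<in> \<F>)" using li X unfolding linked_def by fastforce
  moreover have "{e, g} \<in> \<F>" if "\<F> \<noteq> {}"
    using up that X unfolding upfamily_def by (metis all_not_in_conv order_refl)
  moreover have "principal_family X {e} = {{e}, {e, g}}" "principal_family X {g} = {{g}, {e, g}}"
    "principal_family X {e, g} = {{e, g}}"
    using X by (auto simp: principal_family_def)
  moreover have "S = {} \<or> S = {a, c} \<or> S = {b, c} \<or> S = {c}"
    if "S \<subseteq> {a, b, c}" "\<not> (a \<in> S \<and> b \<in> S)" "S \<noteq> {} \<Longrightarrow> c \<in> S" for a b c and S :: "'a set set"
    using that by blast
  note this[OF sub]
  ultimately show ?thesis by simp
qed

text \<open>The two points form a copy of the group, \<open>principal_family X {e, g}\<close>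
  absorbs them, and the empty family absorbs everything. These are three subgroups covering
  \<open>N2 X\<close>.\<close>

lemma two_group_commutative_clifford:
  assumes iso: "semigroup_iso X f (C 2) (*)"
  shows "commutative_on (N2 X) (ext_op X f) \<and> clifford_on (N2 X) (ext_op X f)"
proof -
  have C2: "C 2 = {1, - 1}" by (auto simp: C_def power2_eq_1_iff)
  obtain h where h: "bij_betw h X (C 2)" and hf: "\<forall>a\<in>X. \<forall>b\<in>X. h (a \<cdot> b) = h a * h b"
    using iso unfolding semigroup_iso_def by blast
  obtain e g where eg: "e \<in> X" "g \<in> X" "h e = 1" "h g = - 1"
    using h unfolding bij_betw_def C2 by (metis imageE insertI1 insertI2)
  have inj: "a = b" if "a \<in> X" "b \<in> X" "h a = h b" for a b
    using h that unfolding bij_betw_def inj_on_def by blast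
  have "x = e \<or> x = g" if x: "x \<in> X" for x
  proof -
    have "h x = 1 \<or> h x = - 1" using h x unfolding bij_betw_def C2 by auto
    then show ?thesis using inj[OF x eg(1)] inj[OF x eg(2)] eg by metis
  qed
  then have X: "X = {e, g}" using eg(1,2) by blast
  have ne: "e \<noteq> g" using eg by auto
  have mult: "e \<cdot> e = e" "e \<cdot> g = g" "g \<cdot> e = g" "g \<cdot> g = e"
    by (rule inj; use eg hf in simp)+
  let ?P = "principal_family X"
  have ps: "?P {e} \<star> ?P {e} = ?P {e}" "?P {e} \<star> ?P {g} = ?P {g}" "?P {g} \<star> ?P {e} = ?P {g}"
    "?P {g} \<star> ?P {g} = ?P {e}" "?P {e} \<star> ?P {e, g} = ?P {e, g}" "?P {g} \<star> ?P {e, g} = ?P {e, g}"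
    "?P {e, g} \<star> ?P {e} = ?P {e, g}" "?P {e, g} \<star> ?P {g} = ?P {e, g}"
    "?P {e, g} \<star> ?P {e, g} = ?P {e, g}"
    using eg mult by (simp_all add: principal_star insert_commute)
  have zero: "{} \<star> \<A> = {}" "\<A> \<in> N2 X \<Longrightarrow> \<A> \<star> {} = {}" for \<A>
    by (auto simp: mem_ext_op N2_def upfamily_def)
  have pz: "?P S \<star> {} = {}" if "S \<noteq> {}" for S
    by (rule zero(2)[OF principal_in_N2[OF that]])
  have "\<A> \<star> \<B> = \<B> \<star> \<A>" if A: "\<A> \<in> N2 X" and B: "\<B> \<in> N2 X" for \<A> \<B>
    using N2_two_elements[OF X ne A] N2_two_elements[OF X ne B]
    by (elim insertE emptyE) (simp_all add: ps zero(1) pz)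
  moreover have "\<exists>G. G \<subseteq> N2 X \<and> \<A> \<in> G \<and> subgroup_on G (ext_op X f)" if A: "\<A> \<in> N2 X" for \<A>
  proof -
    have e0: "{} \<in> N2 X" by (simp add: N2_def upfamily_def linked_def)
    have "subgroup_on {{}} (ext_op X f)" "subgroup_on {?P {e, g}} (ext_op X f)"
      using zero ps by (simp_all add: subgroup_on_def)
    moreover have "subgroup_on {?P {e}, ?P {g}} (ext_op X f)"
      using ps by (simp add: subgroup_on_def)
    moreover have "{{}} \<subseteq> N2 X" "{?P {e, g}} \<subseteq> N2 X" "{?P {e}, ?P {g}} \<subseteq> N2 X"
      using e0 by (simp_all add: principal_in_N2)
    ultimately show ?thesis using N2_two_elements[OF X ne A] by blast
  qed
  ultimately show ?thesis unfolding commutative_on_def clifford_on_def by blast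
qed

section \<open>Classification and the cycle of implications\<close>

text \<open>A non-idempotent element and its square exhaust \<open>X\<close>; without one,
  \<open>X\<close> is a finite chain. The empty semigroup is \<open>L 0\<close>.\<close>

lemma carrier_classification:
  assumes "idempotents_commute_on (N2 X) (ext_op X f)"
    and "sub_clifford_on (N2 X) (ext_op X f) \<or> regular_on (N2 X) (ext_op X f)"
  shows "semigroup_iso X f (C 2) (*) \<or> (\<exists>n. semigroup_iso X f (L n) min)"
proof (cases "\<exists>g\<in>X. g \<cdot> g \<noteq> g")
  case True
  then obtain g where "g \<in> X" "g \<cdot> g \<noteq> g" by blast
  then show ?thesis
    using two_element_iso involution_two_elements[OF assms] cube[OF assms] by blast
next
  case False
  then have idem: "x \<cdot> x = x" if "x \<in> X" for x using that by blast
  have "semigroup_iso X f (L (card X)) min"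
    by (rule finite_chain_iso)
      (use chain_finite[OF assms] idempotents_commute[OF assms] idempotents_chain[OF assms] idem in auto)
  then show ?thesis by blast
qed

end

theorem theorem1p3:
  fixes X :: "'a set" and f :: "'a \<Rightarrow> 'a \<Rightarrow> 'a"
  assumes "semigroup_on X f"
  defines "P1 \<equiv> commutative_on (N2 X) (ext_op X f) \<and> clifford_on (N2 X) (ext_op X f)"
      and "P2 \<equiv> inverse_semigroup_on (N2 X) (ext_op X f)"
      and "P3 \<equiv> idempotents_commute_on (N2 X) (ext_op X f) \<and>
                (sub_clifford_on (N2 X) (ext_op X f) \<or> regular_on (N2 X) (ext_op X f))"
      and "P4 \<equiv> semigroup_iso X f (C 2) (*) \<or> (\<exists>n. semigroup_iso X f (L n) min)"
  shows "(P1 \<longleftrightarrow> P2) \<and> (P2 \<longleftrightarrow> P3) \<and> (P3 \<longleftrightarrow> P4)"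
proof -
  interpret semigroup_carrier X f by unfold_locales fact
  have "P1 \<Longrightarrow> P2"
    unfolding P1_def P2_def using commutative_clifford_imp_inverse[OF N2_semigroup] by blast
  moreover have "P2 \<Longrightarrow> P3"
    unfolding P2_def P3_def
    using inverse_idempotents_commute[OF N2_semigroup] inverse_imp_regular by metis
  moreover have "P3 \<Longrightarrow> P4"
    unfolding P3_def P4_def using carrier_classification by blast
  moreover have "P4 \<Longrightarrow> P1"
    unfolding P4_def P1_def
    using finite_chain_commutative_clifford two_group_commutative_clifford by blast
  ultimately show ?thesis by blast
qed

end
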